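(* Let $X$ be a submetrizable topological space, let $Y$ be a Hausdorff M-space, and let $f\colon X \to Y$ be a continuous, surjective, closed map. Then $Y$ is metrizable.
   Context: A topological space $X$ is submetrizable if there is a topology on the set $X$, contained in the topology of $X$, which is metrizable. A map is closed if it sends closed sets to closed sets. A space $Y$ is an M-space if there is a sequence $(\mathcal{U}_n)_{n\in\omega}$ of open covers of $Y$ such that (i) each $\mathcal{U}_{n+1}$ star-refines $\mathcal{U}_n$ (i.e. for every $U\in\mathcal{U}_{n+1}$ the union of all members of $\mathcal{U}_{n+1}$ meeting $U$ is contained in some member of $\mathcal{U}_n$), and (ii) whenever $y\in Y$ and $y_n\in \mathrm{St}(y,\mathcal{U}_n)=\bigcup\{U\in\mathcal{U}_n : y\in U\}$ for all $n$, the sequence $(y_n)_{n\in\omega}$ has a cluster point in $Y$. (Equivalently, $Y$ admits a continuous closed surjection with countably compact fibers onto a metrizable space.) *)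

theory Defs
  imports "HOL-Analysis.Analysis"
begin

definition submetrizable_space :: "'a topology \<Rightarrow> bool" where
  "submetrizable_space X \<longleftrightarrow>
     (\<exists>T. topspace T = topspace X \<and> (\<forall>U. openin T U \<longrightarrow> openin X U) \<and> metrizable_space T)"

definition open_cover_of :: "'a topology \<Rightarrow> 'a set set \<Rightarrow> bool" where
  "open_cover_of X \<U> \<longleftrightarrow> (\<forall>U\<in>\<U>. openin X U) \<and> \<Union>\<U> = topspace X"

definition point_star :: "'a \<Rightarrow> 'a set set \<Rightarrow> 'a set" where
  "point_star x \<U> = \<Union>{U \<in> \<U>. x \<in> U}"

definition star_refines :: "'a set set \<Rightarrow> 'a set set \<Rightarrow> bool" where
  "star_refines \<V> \<U> \<longleftrightarrow> (\<forall>V\<in>\<V>. \<exists>U\<in>\<U>. \<Union>{W \<in> \<V>. W \<inter> V \<noteq> {}} \<subseteq> U)"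

text \<open>Cluster points are those of the sequence, not of its range: a value that is attained
  infinitely often counts.\<close>

definition seq_cluster_point :: "'a topology \<Rightarrow> (nat \<Rightarrow> 'a) \<Rightarrow> 'a \<Rightarrow> bool" where
  "seq_cluster_point X s x \<longleftrightarrow>
     x \<in> topspace X \<and> (\<forall>U. openin X U \<and> x \<in> U \<longrightarrow> (\<exists>\<^sub>F n in sequentially. s n \<in> U))"

definition M_space :: "'a topology \<Rightarrow> bool" where
  "M_space Y \<longleftrightarrow>
     (\<exists>\<U> :: nat \<Rightarrow> 'a set set.
        (\<forall>n. open_cover_of Y (\<U> n)) \<and>
        (\<forall>n. star_refines (\<U> (Suc n)) (\<U> n)) \<and>
        (\<forall>y\<in>topspace Y. \<forall>s. (\<forall>n. s n \<in> point_star y (\<U> n)) \<longrightarrow> (\<exists>z. seq_cluster_point Y s z)))"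

end

theory Submission
  imports Defs
begin

text \<open>The star-refining covers of \<open>Y\<close> give a pseudometric \<open>\<rho>\<close> on \<open>Y\<close>, and adding \<open>\<rho> (f x) (f x')\<close> to a
  metric for the coarser topology gives a metric \<open>d\<close> on \<open>X\<close>, still with open balls, for which points
  near one fiber have images in the stars of one point. Shrink every fiber to its boundary, or to one
  point if the boundary is empty; the union \<open>C\<close> of these sets is closed. Since \<open>f\<close> is closed, a sequence
  in \<open>X\<close> whose images are distinct and lie in such stars has a cluster point in \<open>X\<close>. This
  makes the restriction of \<open>f\<close> to \<open>C\<close> continuous for \<open>d\<close>, uniformly along each fiber. The \<open>d\<close>-neighbourhoods
  of the shrunken fibers then satisfy the hypotheses of Frink's metrization theorem.\<close>

section \<open>Metrics from sequences of relations and covers\<close>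

text \<open>A pair related at several levels may be linked at any of them, each with its own weight.
  The count \<open>k\<close> of links is carried for the strong induction in
  \<open>chain_less_imp_rel\<close>.\<close>

inductive chain :: "(nat \<Rightarrow> 'a \<Rightarrow> 'a \<Rightarrow> bool) \<Rightarrow> nat \<Rightarrow> 'a \<Rightarrow> 'a \<Rightarrow> real \<Rightarrow> bool"
  for Q where
  chain_refl: "chain Q 0 x x 0"
| chain_step: "chain Q k x y w \<Longrightarrow> Q n y z \<Longrightarrow> chain Q (Suc k) x z (w + (1/2)^n)"

lemma chain_nonneg: "chain Q k x y w \<Longrightarrow> 0 \<le> w"
  by (induction rule: chain.induct) auto

lemma chain_append:
  assumes "chain Q l y z w'" "chain Q k x y w"
  shows "chain Q (k + l) x z (w + w')"
  using assms
proof (induction rule: chain.induct)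
  case (chain_step l y z w' n u)
  then have "chain Q (Suc (k + l)) x u ((w + w') + (1/2)^n)"
    by (blast intro: chain.chain_step)
  then show ?case by (simp add: add.assoc)
qed simp

lemma chain_single: "Q n x y \<Longrightarrow> chain Q 1 x y ((1/2)^n)"
  using chain_step[OF chain_refl, of Q n x y] by simp

lemma chain_sym:
  assumes "chain Q k x y w" and sym: "\<And>n x y. Q n x y \<Longrightarrow> Q n y x"
  shows "chain Q k y x w"
  using assms(1)
proof (induction rule: chain.induct)
  case (chain_step k x y w n z)
  have "chain Q (1 + k) z x ((1/2)^n + w)"
    using chain_append[OF chain_step.IH chain_single] sym chain_step.hyps by blast
  then show ?case by (simp add: add.commute)
qed (rule chain_refl)

text \<open>The link singled out is the one that carries the running weight past \<open>t\<close>.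
  The strict bounds on \<open>k1\<close> and \<open>k2\<close> let an induction on the number of
  links use both parts.\<close>

lemma chain_split:
  assumes "chain Q k x y w" "0 \<le> t" "t < w"
  shows "\<exists>k1 k2 u v m w1 w2. chain Q k1 x u w1 \<and> Q m u v \<and> chain Q k2 v y w2
    \<and> k1 < k \<and> k2 < k \<and> w = w1 + (1/2)^m + w2 \<and> w1 \<le> t \<and> t < w1 + (1/2)^m"
  using assms
proof (induction rule: chain.induct)
  case (chain_step k x y w n z)
  show ?case
  proof (cases "t < w")
    case True
    with chain_step obtain k1 k2 u v m w1 w2 where
      s: "chain Q k1 x u w1" "Q m u v" "chain Q k2 v y w2" "k1 < k" "k2 < k"
         "w = w1 + (1/2)^m + w2" "w1 \<le> t" "t < w1 + (1/2)^m"
      by blast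
    have "chain Q (Suc k2) v z (w2 + (1/2)^n)"
      using s(3) chain_step.hyps by (blast intro: chain.chain_step)
    moreover have "w + (1/2)^n = w1 + (1/2)^m + (w2 + (1/2)^n)"
      using s by simp
    moreover have "k1 < Suc k" "Suc k2 < Suc k"
      using s by auto
    ultimately show ?thesis
      using s by blast
  next
    case False
    have "w + (1/2)^n = w + (1/2)^n + 0" "w \<le> t" "t < w + (1/2)^n" "k < Suc k" "0 < Suc k"
      using False chain_step.prems by auto
    then show ?thesis
      using chain_step.hyps chain_refl[of Q z] by blast
  qed
qed simp

text \<open>Cut the chain at half of its weight: the two parts on either side of the link that crosses the cut
  weigh less than \<open>(1/2)^(n+1)\<close>.\<close>

lemma chain_less_imp_rel:
  assumes refl: "\<And>n x. Q n x x"
    and triple: "\<And>n x y z u. Q (Suc n) x y \<Longrightarrow> Q (Suc n) y z \<Longrightarrow> Q (Suc n) z u \<Longrightarrow> Q n x u"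
  shows "chain Q k x y w \<Longrightarrow> w < (1/2)^n \<Longrightarrow> Q n x y"
proof (induction k arbitrary: x y w n rule: less_induct)
  case (less k)
  have mono: "Q n x y" if "Q (n + i) x y" for n i x y
    using that by (induction i) (auto intro: triple refl)
  show ?case
  proof (cases "w = 0")
    case True
    with less.prems show ?thesis
    proof cases
      case (chain_step k y w' n)
      then show ?thesis
        using True chain_nonneg[OF chain_step(3)] zero_less_power[of "1/2::real" n] by linarith
    qed (auto intro: refl)
  next
    case False
    then have "0 < w"
      using chain_nonneg[OF less.prems(1)] by simp
    then obtain k1 k2 u v m w1 w2 where
      s: "chain Q k1 x u w1" "Q m u v" "chain Q k2 v y w2" "k1 < k" "k2 < k"
         "w = w1 + (1/2)^m + w2" "w1 \<le> w/2" "w/2 < w1 + (1/2)^m"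
      using chain_split[OF less.prems(1), of "w/2"] by auto
    have half: "w/2 < (1/2)^Suc n"
      using less.prems(2) by simp
    have "Q (Suc n) x u"
      using less.IH[OF s(4,1)] s(7) half by (meson le_less_trans)
    moreover have "Q (Suc n) v y"
      using less.IH[OF s(5,3)] s(6,8) half by auto
    \<comment> \<open>The crossing link weighs at most \<open>w\<close>, so its level is above
      \<open>n\<close> and can be lowered to \<open>Suc n\<close>.\<close>
    moreover have "(1/2::real)^m < (1/2)^n"
      using s(6) less.prems(2) chain_nonneg[OF s(1)] chain_nonneg[OF s(3)] by linarith
    then have "Suc n \<le> m"
      by (simp add: power_strict_decreasing_iff)
    then have "Q (Suc n) u v"
      using mono[of "Suc n" "m - Suc n"] s(2) by simp
    ultimately show ?thesis
      using triple by blast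
  qed
qed

section \<open>Pseudometrics from relations and covers\<close>

text \<open>The distance is the infimum of chain weights. \<open>total\<close> gives a chain of
  weight 1 between any two points, concatenation gives the triangle inequality, and the last
  property is \<open>chain_less_imp_rel\<close>.\<close>

lemma pseudometric_from_relations:
  fixes Q :: "nat \<Rightarrow> 'a \<Rightarrow> 'a \<Rightarrow> bool"
  assumes refl: "\<And>n x. Q n x x"
    and sym: "\<And>n x y. Q n x y \<Longrightarrow> Q n y x"
    and triple: "\<And>n x y z u. Q (Suc n) x y \<Longrightarrow> Q (Suc n) y z \<Longrightarrow> Q (Suc n) z u \<Longrightarrow> Q n x u"
    and total: "\<And>x y. Q 0 x y"
  obtains \<rho> :: "'a \<Rightarrow> 'a \<Rightarrow> real" where
    "\<And>x y. 0 \<le> \<rho> x y" "\<And>x. \<rho> x x = 0" "\<And>x y. \<rho> x y = \<rho> y x"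
    "\<And>x y z. \<rho> x z \<le> \<rho> x y + \<rho> y z"
    "\<And>n x y. Q n x y \<Longrightarrow> \<rho> x y \<le> (1/2)^n"
    "\<And>n x y. \<rho> x y < (1/2)^n \<Longrightarrow> Q n x y"
proof
  define A where "A x y = {w. \<exists>k. chain Q k x y w}" for x y
  define \<rho> where "\<rho> x y = Inf (A x y)" for x y
  have ne: "A x y \<noteq> {}" for x y
    using chain_single[of Q, OF total] by (auto simp: A_def)
  have nonneg: "0 \<le> w" if "w \<in> A x y" for w x y
    using that chain_nonneg by (auto simp: A_def)
  then have bdd: "bdd_below (A x y)" for x y
    by (meson bdd_belowI)
  have le: "\<rho> x y \<le> w" if "w \<in> A x y" for w x y
    unfolding \<rho>_def using that bdd by (rule cInf_lower)
  have ex: "\<exists>w\<in>A x y. w < r" if "\<rho> x y < r" for x y r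
    using that cInf_less_iff[OF ne bdd] by (auto simp: \<rho>_def)
  show nn: "0 \<le> \<rho> x y" for x y
    unfolding \<rho>_def using ne nonneg by (rule cInf_greatest)
  show "\<rho> x x = 0" for x
    using le[of 0 x x] nn[of x x] chain_refl[of Q x] by (fastforce simp: A_def)
  show "\<rho> x y = \<rho> y x" for x y
  proof -
    have "chain Q k x y w \<longleftrightarrow> chain Q k y x w" for k w
      using chain_sym[of Q, OF _ sym] by blast
    then have "A x y = A y x"
      by (simp add: A_def)
    then show ?thesis by (simp add: \<rho>_def)
  qed
  show "\<rho> x z \<le> \<rho> x y + \<rho> y z" for x y z
  proof (rule field_le_epsilon)
    fix e :: real assume "0 < e"
    then obtain w w' where w: "w \<in> A x y" "w < \<rho> x y + e/2" and w': "w' \<in> A y z" "w' < \<rho> y z + e/2"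
      using ex[of x y "\<rho> x y + e/2"] ex[of y z "\<rho> y z + e/2"] by auto
    have "w + w' \<in> A x z"
      using w(1) w'(1) chain_append by (fastforce simp: A_def)
    then show "\<rho> x z \<le> \<rho> x y + \<rho> y z + e"
      using le w(2) w'(2) by fastforce
  qed
  show "\<rho> x y \<le> (1/2)^n" if "Q n x y" for n x y
    using le chain_single[of Q, OF that] by (auto simp: A_def)
  show "Q n x y" if less: "\<rho> x y < (1/2)^n" for n x y
  proof -
    obtain w k where "chain Q k x y w" "w < (1/2)^n"
      using ex[OF less] by (auto simp: A_def)
    then show ?thesis
      by (rule chain_less_imp_rel[rotated 2]) (rule refl, rule triple)
  qed
qed

lemma pseudometric_from_covers:
  fixes \<G> :: "nat \<Rightarrow> 'a set set"
  assumes cover: "\<And>n. \<Union>(\<G> n) = S"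
    and pairs: "\<And>n A B. \<lbrakk>A \<in> \<G> (Suc n); B \<in> \<G> (Suc n); A \<inter> B \<noteq> {}\<rbrakk> \<Longrightarrow> \<exists>C\<in>\<G> n. A \<union> B \<subseteq> C"
  obtains \<rho> :: "'a \<Rightarrow> 'a \<Rightarrow> real" where
    "\<And>x y. 0 \<le> \<rho> x y" "\<And>x. \<rho> x x = 0" "\<And>x y. \<rho> x y = \<rho> y x"
    "\<And>x y z. \<rho> x z \<le> \<rho> x y + \<rho> y z"
    "\<And>n x y. y \<in> point_star x (\<G> (2*n)) \<Longrightarrow> \<rho> x y \<le> (1/2)^n"
    "\<And>n x y. x \<in> S \<Longrightarrow> \<rho> x y < (1/2)^n \<Longrightarrow> y \<in> point_star x (\<G> n)"
proof -
  define R where "R n x y \<longleftrightarrow> (\<exists>A\<in>\<G> n. x \<in> A \<and> y \<in> A)" for n x y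
  have star: "y \<in> point_star x (\<G> n) \<longleftrightarrow> R n x y" for n x y
    by (auto simp: point_star_def R_def)
  have comp: "R n x z" if xy: "R (Suc n) x y" and yz: "R (Suc n) y z" for n x y z
  proof -
    obtain A B where AB: "A \<in> \<G> (Suc n)" "x \<in> A" "y \<in> A" "B \<in> \<G> (Suc n)" "y \<in> B" "z \<in> B"
      using xy yz unfolding R_def by blast
    then obtain C where "C \<in> \<G> n" "A \<union> B \<subseteq> C"
      using pairs[of A n B] by blast
    then show ?thesis
      using AB unfolding R_def by blast
  qed
  have step: "R n x y" if "R (Suc n) x y" for n x y
    using that comp[of n x x y] unfolding R_def by blast
  have mono: "R n x y" if "R (n + i) x y" for n i x y
    using that by (induction i) (auto intro: step)
  \<comment> \<open>Points outside \<open>S\<close> lie in no member, so the diagonal is added to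
    get reflexivity on the whole type.\<close>
  define R' where "R' n x y \<longleftrightarrow> x = y \<or> R n x y" for n x y
  have comp': "R' n x z" if "R' (Suc n) x y" "R' (Suc n) y z" for n x y z
    using that comp step unfolding R'_def by blast
  \<comment> \<open>Passing to every second cover turns the composition of pairs into one of triples.\<close>
  define Q where "Q n x y \<longleftrightarrow> n = 0 \<or> R' (2 * (n - 1)) x y" for n x y
  have triple: "Q n x u" if "Q (Suc n) x y" "Q (Suc n) y z" "Q (Suc n) z u" for n x y z u
  proof (cases n)
    case (Suc m)
    then have xy: "R' (Suc (Suc (2*m))) x y" and yz: "R' (Suc (Suc (2*m))) y z"
      and zu: "R' (Suc (Suc (2*m))) z u"
      using that by (simp_all add: Q_def)
    have "R' (Suc (2*m)) z u"
      using comp'[OF zu, of u] by (simp add: R'_def)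
    then have "R' (2*m) x u"
      using comp'[OF comp'[OF xy yz]] by blast
    then show ?thesis
      using Suc by (simp add: Q_def)
  qed (simp add: Q_def)
  obtain \<rho> :: "'a \<Rightarrow> 'a \<Rightarrow> real" where \<rho>:
    "\<And>x y. 0 \<le> \<rho> x y" "\<And>x. \<rho> x x = 0" "\<And>x y. \<rho> x y = \<rho> y x"
    "\<And>x y z. \<rho> x z \<le> \<rho> x y + \<rho> y z"
    "\<And>n x y. Q n x y \<Longrightarrow> \<rho> x y \<le> (1/2)^n"
    "\<And>n x y. \<rho> x y < (1/2)^n \<Longrightarrow> Q n x y"
  proof (rule pseudometric_from_relations[of Q])
    show "Q n x x" "Q 0 x y" for n x y
      by (auto simp: Q_def R'_def)
    show "Q n y x" if "Q n x y" for n x y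
      using that by (auto simp: Q_def R'_def R_def)
    show "Q n x u" if "Q (Suc n) x y" "Q (Suc n) y z" "Q (Suc n) z u" for n x y z u
      using that by (rule triple)
  qed (rule that)
  show ?thesis
  \<comment> \<open>Making \<open>Q 0\<close> total shifted the levels by one; the factor 2 undoes
    this shift in both estimates.\<close>
  proof (rule that[of "\<lambda>x y. 2 * \<rho> x y"])
    show "2 * \<rho> x z \<le> 2 * \<rho> x y + 2 * \<rho> y z" for x y z
      using \<rho>(4)[of x z y] by simp
    show "2 * \<rho> x y \<le> (1/2)^n" if "y \<in> point_star x (\<G> (2*n))" for n x y
      using \<rho>(5)[of "Suc n" x y] that by (simp add: star Q_def R'_def)
    show "y \<in> point_star x (\<G> n)" if "x \<in> S" "2 * \<rho> x y < (1/2)^n" for n x y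
    proof -
      have "Q (Suc n) x y"
        using \<rho>(6)[of x y "Suc n"] that(2) by simp
      moreover have "R n x x"
        using that(1) cover[of n] by (auto simp: R_def)
      ultimately show ?thesis
        using mono[of n n x y] by (auto simp: star Q_def R'_def mult_2)
    qed
  qed (use \<rho> in auto)
qed

text \<open>Frink's metrization theorem. The index \<open>i n y\<close> depends on \<open>y\<close>, and of two intersecting
  sets \<open>W (i (Suc n) x) x\<close>, \<open>W (i (Suc n) y) y\<close> the one with the smaller index
  has its centre serve for the set of level \<open>n\<close> that contains both.\<close>

lemma frink_metrization:
  fixes W :: "nat \<Rightarrow> 'a \<Rightarrow> 'a set"
  assumes "t1_space Y"
    and sub: "\<And>n y. W n y \<subseteq> topspace Y"
    and dec: "\<And>n y. W (Suc n) y \<subseteq> W n y"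
    and nbhd: "\<And>n y. y \<in> topspace Y \<Longrightarrow> \<exists>V. openin Y V \<and> y \<in> V \<and> V \<subseteq> W n y"
    and base: "\<And>V y. openin Y V \<Longrightarrow> y \<in> V \<Longrightarrow> \<exists>n. W n y \<subseteq> V"
    and frink: "\<And>n y. y \<in> topspace Y \<Longrightarrow>
      \<exists>m. \<forall>z\<in>topspace Y. W m y \<inter> W m z \<noteq> {} \<longrightarrow> W m z \<subseteq> W n y"
  shows "metrizable_space Y"
proof -
  have anti: "W m y \<subseteq> W n y" if "n \<le> m" for m n y
    using dec that by (rule lift_Suc_antimono_le)
  have mem: "y \<in> W n y" if "y \<in> topspace Y" for n y
    using nbhd[OF that] by blast
  obtain m where m: "\<And>n y z. \<lbrakk>y \<in> topspace Y; z \<in> topspace Y; W (m n y) y \<inter> W (m n y) z \<noteq> {}\<rbrakk>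
      \<Longrightarrow> W (m n y) z \<subseteq> W n y"
  proof -
    have "\<forall>n y. \<exists>m. y \<in> topspace Y \<longrightarrow>
        (\<forall>z\<in>topspace Y. W m y \<inter> W m z \<noteq> {} \<longrightarrow> W m z \<subseteq> W n y)"
      using frink by blast
    then obtain m where "\<forall>n y. y \<in> topspace Y \<longrightarrow>
        (\<forall>z\<in>topspace Y. W (m n y) y \<inter> W (m n y) z \<noteq> {} \<longrightarrow> W (m n y) z \<subseteq> W n y)"
      by metis
    then show thesis
      using that by blast
  qed
  \<comment> \<open>The recursion makes \<open>i (Suc n) y\<close> exceed \<open>i n y\<close> and
    reach the index \<open>m (i n y) y\<close> that absorbs intersecting sets into
    \<open>W (i n y) y\<close>.\<close>
  define i where "i = rec_nat (\<lambda>y. 0) (\<lambda>_ g y. max (Suc (g y)) (m (g y) y))"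
  have i_Suc: "i (Suc n) y = max (Suc (i n y)) (m (i n y) y)" for n y
    by (simp add: i_def)
  have i_ge: "n \<le> i n y" for n y
    by (induction n) (auto simp: i_Suc)
  have absorb: "W (i (Suc n) x) x \<union> W (i (Suc n) y) y \<subseteq> W (i n x) x"
    if xy: "x \<in> topspace Y" "y \<in> topspace Y" and le: "i (Suc n) x \<le> i (Suc n) y"
      and meet: "W (i (Suc n) x) x \<inter> W (i (Suc n) y) y \<noteq> {}" for n x y
  proof -
    have ge: "m (i n x) x \<le> i (Suc n) x" "i n x \<le> i (Suc n) x"
      by (auto simp: i_Suc)
    have "W (i (Suc n) x) x \<subseteq> W (m (i n x) x) x" "W (i (Suc n) y) y \<subseteq> W (m (i n x) x) y"
      using anti ge le by (meson order_trans)+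
    then have "W (i (Suc n) y) y \<subseteq> W (i n x) x"
      using m[OF xy, of "i n x"] meet by blast
    then show ?thesis
      using anti[OF ge(2)] by blast
  qed
  define \<G> where "\<G> n = (\<lambda>y. W (i n y) y) ` topspace Y" for n
  have cover: "\<Union>(\<G> n) = topspace Y" for n
    using sub mem by (fastforce simp: \<G>_def)
  have pairs: "\<exists>C\<in>\<G> n. A \<union> B \<subseteq> C" if "A \<in> \<G> (Suc n)" "B \<in> \<G> (Suc n)" "A \<inter> B \<noteq> {}" for n A B
  proof -
    obtain x y where xy: "x \<in> topspace Y" "y \<in> topspace Y"
        "A = W (i (Suc n) x) x" "B = W (i (Suc n) y) y"
      using \<open>A \<in> \<G> (Suc n)\<close> \<open>B \<in> \<G> (Suc n)\<close> by (auto simp: \<G>_def)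
    show ?thesis
    proof (cases "i (Suc n) x \<le> i (Suc n) y")
      case True
      then show ?thesis
        using absorb[of x y n] xy that(3) by (auto simp: \<G>_def)
    next
      case False
      then show ?thesis
        using absorb[of y x n] xy that(3) by (auto simp: \<G>_def Int_commute Un_commute)
    qed
  qed
  obtain \<rho> :: "'a \<Rightarrow> 'a \<Rightarrow> real" where \<rho>:
    "\<And>x y. 0 \<le> \<rho> x y" "\<And>x. \<rho> x x = 0" "\<And>x y. \<rho> x y = \<rho> y x"
    "\<And>x y z. \<rho> x z \<le> \<rho> x y + \<rho> y z"
    "\<And>n x y. y \<in> point_star x (\<G> (2*n)) \<Longrightarrow> \<rho> x y \<le> (1/2)^n"
    "\<And>n x y. x \<in> topspace Y \<Longrightarrow> \<rho> x y < (1/2)^n \<Longrightarrow> y \<in> point_star x (\<G> n)"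
  proof (rule pseudometric_from_covers)
    show "\<Union>(\<G> n) = topspace Y" for n
      by (rule cover)
    show "\<exists>C\<in>\<G> n. A \<union> B \<subseteq> C" if "A \<in> \<G> (Suc n)" "B \<in> \<G> (Suc n)" "A \<inter> B \<noteq> {}" for n A B
      using that by (rule pairs)
  qed (rule that)
  \<comment> \<open>A member of \<open>\<G> (m k x)\<close> containing \<open>x\<close> lies in
    \<open>W (m k x) c\<close> for its centre \<open>c\<close>. This set meets
    \<open>W (m k x) x\<close> at \<open>x\<close>, so it is inside \<open>W k x\<close>.\<close>
  have small: "\<exists>r>0. \<forall>y. \<rho> x y < r \<longrightarrow> y \<in> V" if V: "openin Y V" "x \<in> V" for x V
  proof -
    have x: "x \<in> topspace Y"
      using V openin_subset by blast
    obtain k where k: "W k x \<subseteq> V"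
      using base[OF V] by blast
    let ?a = "m k x"
    have "y \<in> V" if y: "\<rho> x y < (1/2)^?a" for y
    proof -
      obtain c where c: "c \<in> topspace Y" "x \<in> W (i ?a c) c" "y \<in> W (i ?a c) c"
        using \<rho>(6)[OF x y] by (auto simp: point_star_def \<G>_def)
      have "W (i ?a c) c \<subseteq> W ?a c"
        using anti i_ge by blast
      then show ?thesis
        using m[OF x c(1), of k] mem[OF x, of ?a] c k by blast
    qed
    then show ?thesis
      by (intro exI[of _ "(1/2)^?a"]) auto
  qed
  have pos: "x = y" if xy: "x \<in> topspace Y" "y \<in> topspace Y" "\<rho> x y = 0" for x y
  proof (rule ccontr)
    assume "x \<noteq> y"
    then obtain V where "openin Y V" "x \<in> V" "y \<notin> V"
      using \<open>t1_space Y\<close> xy unfolding t1_space_def by blast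
    then show False
      using small[of V x] xy(3) by auto
  qed
  interpret \<rho>: Metric_space "topspace Y" \<rho>
  proof
    show "0 \<le> \<rho> x y" "\<rho> x y = \<rho> y x" for x y
      by (fact \<rho>)+
    show "\<rho> x y = 0 \<longleftrightarrow> x = y" if "x \<in> topspace Y" "y \<in> topspace Y" for x y
      using that pos \<rho>(2) by blast
    show "\<rho> x z \<le> \<rho> x y + \<rho> y z" for x y z
      by (fact \<rho>)
  qed
  have "openin Y V \<longleftrightarrow> openin \<rho>.mtopology V" for V
  proof
    assume V: "openin Y V"
    show "openin \<rho>.mtopology V"
      unfolding \<rho>.openin_mtopology
    proof (intro conjI allI impI)
      fix x assume "x \<in> V"
      then show "\<exists>r>0. \<rho>.mball x r \<subseteq> V"
        using small[OF V] by (force simp: \<rho>.mball_def)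
    qed (rule openin_subset[OF V])
  next
    assume V: "openin \<rho>.mtopology V"
    show "openin Y V"
    proof (subst openin_subopen, intro ballI)
      fix x assume "x \<in> V"
      then obtain r where r: "r > 0" "\<rho>.mball x r \<subseteq> V" and x: "x \<in> topspace Y"
        using V unfolding \<rho>.openin_mtopology by blast
      obtain n where n: "(1/2::real)^n < r"
        using real_arch_pow_inv[OF r(1), of "1/2"] by auto
      obtain O' where O': "openin Y O'" "x \<in> O'" "O' \<subseteq> W (i (2*n) x) x"
        using nbhd[OF x] by blast
      have "O' \<subseteq> V"
      proof
        fix y assume y: "y \<in> O'"
        then have "y \<in> point_star x (\<G> (2*n))"
          using O' x by (auto simp: point_star_def \<G>_def)
        then have "\<rho> x y < r"
          using \<rho>(5) n by (meson le_less_trans)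
        then show "y \<in> V"
          using r(2) x y O'(1) openin_subset by (fastforce simp: \<rho>.mball_def)
      qed
      then show "\<exists>T. openin Y T \<and> x \<in> T \<and> T \<subseteq> V"
        using O' by blast
    qed
  qed
  then have "Y = \<rho>.mtopology"
    by (simp add: topology_eq)
  then show ?thesis
    using \<rho>.metrizable_space_mtopology by simp
qed

text \<open>Each choice has to avoid only the finitely many values of \<open>f\<close> already
  taken. The lemma supplies the injectivity required in
  \<open>seq_cluster_point_lift\<close>.\<close>

lemma injective_selection:
  fixes f :: "'a \<Rightarrow> 'b"
  assumes "\<And>n E. finite E \<Longrightarrow> \<exists>x. P (n::nat) x \<and> f x \<notin> E"
  obtains s where "\<And>n. P n (s n)" "inj (f \<circ> s)"
proof -
  have "\<exists>s. \<forall>n::nat. P n (s n) \<and> f (s n) \<notin> (f \<circ> s) ` {..<n}"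
  proof (rule dependent_wellorder_choice)
    show "\<exists>x. P n x \<and> f x \<notin> (f \<circ> s) ` {..<n}" for n s
      by (rule assms) simp
  qed (auto simp: image_iff)
  then obtain s where s: "\<And>n. P n (s n)" "\<And>n. f (s n) \<notin> (f \<circ> s) ` {..<n}"
    by blast
  have "inj (f \<circ> s)"
  proof (rule linorder_injI)
    show "(f \<circ> s) m \<noteq> (f \<circ> s) n" if "m < n" for m n
      using s(2)[of n] that by (metis comp_apply image_eqI lessThan_iff)
  qed
  then show thesis
    using that s(1) by blast
qed

section \<open>Closed maps onto M-spaces\<close>

text \<open>By \<open>ball_open\<close> the topology of \<open>d\<close> is coarser than that of
  \<open>X\<close>, possibly strictly. Of the star refinement only its consequence
  \<open>near_star\<close> is kept.\<close>

locale closed_map_onto_M_space =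
  fixes X :: "'a topology" and Y :: "'b topology" and f :: "'a \<Rightarrow> 'b"
    and d :: "'a \<Rightarrow> 'a \<Rightarrow> real" and \<U> :: "nat \<Rightarrow> 'b set set"
  assumes cont: "continuous_map X Y f"
    and surj: "f ` topspace X = topspace Y"
    and closed: "closed_map X Y f"
    and Hausdorff: "Hausdorff_space Y"
    and metric: "Metric_space (topspace X) d"
    and ball_open: "\<And>x r. x \<in> topspace X \<Longrightarrow> openin X {x' \<in> topspace X. d x x' < r}"
    and near_star: "\<And>x x' n. \<lbrakk>x \<in> topspace X; x' \<in> topspace X; d x x' < (1/2)^n\<rbrakk>
      \<Longrightarrow> f x' \<in> point_star (f x) (\<U> n)"
    and cluster: "\<And>y s. \<lbrakk>y \<in> topspace Y; \<And>n. s n \<in> point_star y (\<U> n)\<rbrakk>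
      \<Longrightarrow> \<exists>z. seq_cluster_point Y s z"
begin

sublocale Metric_space "topspace X" d
  by (rule metric)

lemma t1: "t1_space X"
  unfolding t1_space_def
proof (intro ballI impI)
  fix x y assume "x \<in> topspace X" "y \<in> topspace X" "x \<noteq> y"
  then show "\<exists>U. openin X U \<and> x \<in> U \<and> y \<notin> U"
    using ball_open[of x "d x y"] by (intro exI[of _ "{x' \<in> topspace X. d x x' < d x y}"]) auto
qed

lemma openin_remove_finite: "openin X W \<Longrightarrow> finite E \<Longrightarrow> openin X (W - E)"
proof -
  assume W: "openin X W" and E: "finite E"
  have "closedin X (topspace X \<inter> E)"
    using t1 E by (auto simp: t1_space_closedin_finite)
  then have "openin X (W - (topspace X \<inter> E))"
    using W by blast
  moreover have "W - (topspace X \<inter> E) = W - E"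
    using openin_subset[OF W] by blast
  ultimately show ?thesis by simp
qed

lemma openin_vimage_finite_compl:
  assumes "finite E"
  shows "openin X {x \<in> topspace X. f x \<notin> E}"
proof -
  have "closedin Y (topspace Y \<inter> E)"
    using Hausdorff_imp_t1_space[OF Hausdorff] assms by (auto simp: t1_space_closedin_finite)
  then have "openin X {x \<in> topspace X. f x \<in> topspace Y - topspace Y \<inter> E}"
    by (intro openin_continuous_map_preimage[OF cont]) blast
  moreover have "{x \<in> topspace X. f x \<in> topspace Y - topspace Y \<inter> E} = {x \<in> topspace X. f x \<notin> E}"
    using surj by blast
  ultimately show ?thesis by simp
qed

section \<open>Cluster points in the domain\<close>

lemma seq_cluster_point_ball:
  assumes "seq_cluster_point X s p" "0 < r"
  shows "\<exists>n\<ge>N. s n \<in> topspace X \<and> d p (s n) < r"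
proof -
  have p: "p \<in> topspace X"
    using assms(1) by (simp add: seq_cluster_point_def)
  then have "p \<in> {x \<in> topspace X. d p x < r}"
    using assms(2) by simp
  then have "\<exists>\<^sub>F n in sequentially. s n \<in> {x \<in> topspace X. d p x < r}"
    using assms(1) ball_open[OF p] unfolding seq_cluster_point_def by blast
  then show ?thesis
    unfolding frequently_sequentially by blast
qed

lemma seq_cluster_point_preimage:
  assumes "seq_cluster_point X s p" "openin Y V" "f p \<in> V"
  shows "\<exists>n. f (s n) \<in> V"
proof -
  have "p \<in> {x \<in> topspace X. f x \<in> V}"
    using assms by (simp add: seq_cluster_point_def)
  then have "\<exists>\<^sub>F n in sequentially. s n \<in> {x \<in> topspace X. f x \<in> V}"
    using assms(1) openin_continuous_map_preimage[OF cont assms(2)]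
    unfolding seq_cluster_point_def by blast
  then show ?thesis
    unfolding frequently_sequentially by blast
qed

text \<open>The images cluster at some \<open>z\<close>. Since \<open>f\<close> is closed,
  \<open>z\<close> is the image of a point in the closure of the terms not mapped to
  \<open>z\<close>; that point is none of these terms, so it is a cluster point because
  \<open>X\<close> is T1.\<close>

lemma seq_cluster_point_lift:
  assumes s: "\<And>n. s n \<in> topspace X" "inj (f \<circ> s)"
    and y: "y \<in> topspace Y" "\<And>n. f (s n) \<in> point_star y (\<U> n)"
  shows "\<exists>p. seq_cluster_point X s p"
proof -
  obtain z where z: "seq_cluster_point Y (f \<circ> s) z"
    using cluster[of y "f \<circ> s"] y by auto
  define A where "A = {n. f (s n) \<noteq> z}"
  define C where "C = X closure_of (s ` A)"
  have sub: "s ` A \<subseteq> C"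
    unfolding C_def using s(1) by (intro closure_of_subset) auto
  have clo: "closedin Y (f ` C)"
    using closed by (simp add: C_def closed_map_def)
  have "z \<in> f ` C"
  proof (rule ccontr)
    assume "z \<notin> f ` C"
    \<comment> \<open>A neighbourhood of \<open>z\<close> missing the image of \<open>C\<close> is
      visited only by terms mapped to \<open>z\<close>, and injectivity allows at most one of
      those.\<close>
    then have "\<exists>\<^sub>F n in sequentially. (f \<circ> s) n \<in> topspace Y - f ` C"
      using z clo unfolding seq_cluster_point_def by blast
    then have fr: "\<exists>\<^sub>F n in sequentially. f (s n) = z"
      by (rule frequently_elim1) (use sub in \<open>auto simp: A_def\<close>)
    then obtain a b where "f (s a) = z" "Suc a \<le> b" "f (s b) = z"
      unfolding frequently_sequentially by blast
    then show False
      using injD[OF s(2), of a b] by simp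
  qed
  then obtain p where p: "p \<in> C" "f p = z"
    by blast
  have "\<exists>\<^sub>F n in sequentially. s n \<in> W" if W: "openin X W" "p \<in> W" for W
    unfolding frequently_sequentially
  proof
    fix N
    \<comment> \<open>No term indexed by \<open>A\<close> equals \<open>p\<close>, since its image
      is not \<open>z\<close>; finitely many of them can be removed from \<open>W\<close>.\<close>
    have "openin X (W - s ` (A \<inter> {..<N}))"
      using W(1) by (intro openin_remove_finite) auto
    moreover have "p \<in> W - s ` (A \<inter> {..<N})"
      using W(2) p(2) by (auto simp: A_def)
    ultimately obtain n where "n \<in> A" "s n \<in> W - s ` (A \<inter> {..<N})"
      using p(1) unfolding C_def in_closure_of by blast
    then show "\<exists>n\<ge>N. s n \<in> W"
      by (intro exI[of _ n]) (auto simp: not_less[symmetric])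
  qed
  moreover have "p \<in> topspace X"
    using p(1) by (simp add: C_def in_closure_of)
  ultimately show ?thesis
    unfolding seq_cluster_point_def by blast
qed

section \<open>Boundaries of fibers and their shrunken forms\<close>

text \<open>This is the topological boundary of the fiber over \<open>y\<close>, as fibers are
  closed.\<close>

definition boundary_fiber :: "'b \<Rightarrow> 'a set" where
  "boundary_fiber y = {x \<in> topspace X. f x = y \<and>
     (\<forall>W. openin X W \<and> x \<in> W \<longrightarrow> (\<exists>x'\<in>W. f x' \<noteq> y))}"

text \<open>A fiber with empty boundary is open, and one point of it keeps the restricted map onto
  \<open>Y\<close>. Other interior points are dropped: small moves in \<open>X\<close> cannot change
  their images, while the arguments below need such moves.\<close>

definition core_fiber :: "'b \<Rightarrow> 'a set" where
  "core_fiber y = (if boundary_fiber y = {} then {SOME x. x \<in> topspace X \<and> f x = y}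
     else boundary_fiber y)"

lemma core_fiber_singleton_or_boundary:
  "(\<exists>a. core_fiber y = {a}) \<or> core_fiber y = boundary_fiber y"
  by (auto simp: core_fiber_def)

lemma core_fiber_nonempty: "core_fiber y \<noteq> {}"
  by (simp add: core_fiber_def)

lemma core_fiberD:
  assumes "y \<in> topspace Y" "x \<in> core_fiber y"
  shows "x \<in> topspace X" "f x = y"
proof -
  define x0 where "x0 = (SOME x. x \<in> topspace X \<and> f x = y)"
  have "\<exists>x. x \<in> topspace X \<and> f x = y"
    using assms(1) surj by (metis imageE)
  then have x0: "x0 \<in> topspace X \<and> f x0 = y"
    unfolding x0_def by (rule someI_ex)
  have "x = x0 \<or> x \<in> boundary_fiber y"
    using assms(2) unfolding core_fiber_def x0_def[symmetric] by (metis singletonD)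
  then show "x \<in> topspace X" "f x = y"
    using x0 unfolding boundary_fiber_def by blast+
qed

text \<open>Values in \<open>E\<close> other than \<open>y\<close> are avoided on a neighbourhood of
  \<open>x\<close>, as finite sets are closed in \<open>Y\<close>; \<open>y\<close> itself is
  avoided because \<open>x\<close> is a boundary point.\<close>

lemma boundary_fiber_avoid:
  assumes x: "x \<in> boundary_fiber y" and W: "openin X W" "x \<in> W" and E: "finite E"
  shows "\<exists>x'\<in>W. f x' \<notin> E"
proof -
  let ?W = "W \<inter> {x \<in> topspace X. f x \<notin> E - {y}}"
  have "openin X ?W"
    using W(1) E by (intro openin_Int openin_vimage_finite_compl) auto
  moreover have "x \<in> ?W"
    using x W(2) by (auto simp: boundary_fiber_def)
  ultimately obtain x' where "x' \<in> ?W" "f x' \<noteq> y"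
    using x unfolding boundary_fiber_def by blast
  then show ?thesis by blast
qed

lemma boundary_fiber_perturb:
  assumes x: "x \<in> boundary_fiber y" and V: "openin Y V" "y \<in> V" and "0 < r" and E: "finite E"
  shows "\<exists>x'\<in>topspace X. d x x' < r \<and> f x' \<in> V \<and> f x' \<notin> E"
proof -
  have x': "x \<in> topspace X" "f x = y"
    using x by (auto simp: boundary_fiber_def)
  have "openin X ({x' \<in> topspace X. d x x' < r} \<inter> {x \<in> topspace X. f x \<in> V})"
    using x' V by (intro openin_Int ball_open openin_continuous_map_preimage[OF cont]) auto
  then show ?thesis
    using boundary_fiber_avoid[OF x _ _ E] x' V \<open>0 < r\<close> by fastforce
qed

section \<open>Core fibers and the metric\<close>

text \<open>A fiber need not be closed for the coarser topology of \<open>d\<close>. In the boundary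
  case, points of the fiber tending to \<open>p\<close> are moved slightly to have distinct images
  near \<open>y\<close>; the new sequence clusters at \<open>p\<close> in \<open>X\<close>, which
  contradicts the separation of \<open>f p\<close> from \<open>y\<close>.\<close>

lemma core_fiber_limit:
  assumes y: "y \<in> topspace Y" and p: "p \<in> topspace X"
    and lim: "\<And>r. 0 < r \<Longrightarrow> \<exists>a\<in>core_fiber y. d a p < r"
  shows "f p = y"
proof (cases "core_fiber y = boundary_fiber y")
  case False
  then obtain a where a: "core_fiber y = {a}"
    using core_fiber_singleton_or_boundary by blast
  then have aX: "a \<in> topspace X" "f a = y"
    using core_fiberD[OF y, of a] by auto
  have "\<not> 0 < d a p"
    using lim[of "d a p"] a by auto
  then have "a = p"
    using aX p by (metis nonneg less_eq_real_def zero)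
  then show ?thesis
    using aX by simp
next
  case True
  show ?thesis
  proof (rule ccontr)
    assume neq: "f p \<noteq> y"
    have "f p \<in> topspace Y"
      using p surj by blast
    then obtain V V' where V: "openin Y V" "y \<in> V" "openin Y V'" "f p \<in> V'" "disjnt V V'"
      using Hausdorff y neq unfolding Hausdorff_space_def by metis
    define P where "P n x \<longleftrightarrow> x \<in> topspace X \<and> f x \<in> V \<and> d x p < (1/2)^n
      \<and> f x \<in> point_star y (\<U> n)" for n x
    have "\<exists>x. P n x \<and> f x \<notin> E" if E: "finite E" for n E
    proof -
      \<comment> \<open>This distance is spent twice: between \<open>p\<close> and \<open>a\<close>,
        and in moving \<open>a\<close> to \<open>x\<close>.\<close>
      let ?r = "(1/2::real)^Suc n"
      obtain a where a: "a \<in> boundary_fiber y" "d a p < ?r"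
        using lim[of ?r] True by auto
      then have aX: "a \<in> topspace X" "f a = y"
        by (auto simp: boundary_fiber_def)
      obtain x where x: "x \<in> topspace X" "d a x < ?r" "f x \<in> V" "f x \<notin> E"
        using boundary_fiber_perturb[OF a(1) V(1,2) _ E, of ?r] by auto
      have "d x p < (1/2)^n"
        using triangle[OF x(1) aX(1) p] a(2) x(2) commute[of x a] by simp
      moreover have "d a x < (1/2)^n"
        by (rule less_le_trans[OF x(2)]) simp
      then have "f x \<in> point_star y (\<U> n)"
        using near_star[OF aX(1) x(1)] aX(2) by simp
      ultimately show ?thesis
        using x by (auto simp: P_def)
    qed
    then obtain s where s: "\<And>n. P n (s n)" "inj (f \<circ> s)"
      by (rule injective_selection[of P f]) auto
    then obtain q where q: "seq_cluster_point X s q"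
      using seq_cluster_point_lift[of s y] y by (auto simp: P_def)
    then have qX: "q \<in> topspace X"
      by (simp add: seq_cluster_point_def)
    \<comment> \<open>The sequence tends to \<open>p\<close> for \<open>d\<close>, and a cluster
      point in \<open>X\<close> is also one for \<open>d\<close>.\<close>
    have "q = p"
    proof (rule ccontr)
      assume "q \<noteq> p"
      then have pos: "0 < d q p / 2"
        using qX p by (metis half_gt_zero mdist_pos_less)
      obtain N where N: "(1/2::real)^N < d q p / 2"
        using real_arch_pow_inv[OF pos, of "1/2"] by auto
      obtain n where n: "N \<le> n" "s n \<in> topspace X" "d q (s n) < d q p / 2"
        using seq_cluster_point_ball[OF q pos] by blast
      have "d (s n) p < (1/2)^n"
        using s(1) by (simp add: P_def)
      also have "(1/2::real)^n \<le> (1/2)^N"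
        using n(1) by (simp add: power_decreasing)
      finally show False
        using triangle[OF qX n(2) p] n(3) N by simp
    qed
    then obtain n where "f (s n) \<in> V'"
      using seq_cluster_point_preimage[OF q V(3)] V(4) by blast
    then show False
      using s(1)[of n] V(5) by (auto simp: P_def disjnt_iff)
  qed
qed

text \<open>Otherwise points ever closer to the core fiber have distinct images outside
  \<open>V\<close>. By \<open>near_star\<close> they cluster in \<open>X\<close>, at distance zero
  from the core fiber, so by \<open>core_fiber_limit\<close> at a point over \<open>y\<close>, and
  some image falls into \<open>V\<close>.\<close>

lemma near_core_fiber_finite_exceptions:
  assumes y: "y \<in> V" and V: "openin Y V"
  shows "\<exists>r>0. \<exists>E. finite E \<and>
    (\<forall>a\<in>core_fiber y. \<forall>x\<in>topspace X. d a x < r \<longrightarrow> f x \<in> V \<union> E)"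
proof (rule ccontr)
  assume contra: "\<not> ?thesis"
  have yY: "y \<in> topspace Y"
    using y V openin_subset by blast
  define P where "P n x \<longleftrightarrow> x \<in> topspace X \<and> f x \<notin> V \<and> (\<exists>a\<in>core_fiber y. d a x < (1/2)^n)"
    for n x
  have "\<exists>x. P n x \<and> f x \<notin> E" if E: "finite E" for n E
  proof -
    have "0 < (1/2::real)^n" by simp
    with contra E show ?thesis
      unfolding P_def by blast
  qed
  then obtain s where s: "\<And>n. P n (s n)" "inj (f \<circ> s)"
    by (rule injective_selection[of P f]) auto
  have "f (s n) \<in> point_star y (\<U> n)" for n
    using s(1)[of n] core_fiberD[OF yY] near_star unfolding P_def by metis
  then obtain p where p: "seq_cluster_point X s p"
    using seq_cluster_point_lift[of s y] s yY by (auto simp: P_def)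
  then have pX: "p \<in> topspace X"
    by (simp add: seq_cluster_point_def)
  have "\<exists>a\<in>core_fiber y. d a p < r" if "0 < r" for r
  proof -
    have r: "0 < r/2"
      using that by simp
    obtain N where N: "(1/2::real)^N < r/2"
      using real_arch_pow_inv[OF r, of "1/2"] by auto
    obtain n where n: "N \<le> n" "s n \<in> topspace X" "d p (s n) < r/2"
      using seq_cluster_point_ball[OF p r] by blast
    obtain a where a: "a \<in> core_fiber y" "d a (s n) < (1/2)^n"
      using s(1)[of n] by (auto simp: P_def)
    have "(1/2::real)^n \<le> (1/2)^N"
      using n(1) by (simp add: power_decreasing)
    then have "d a p < r"
      using triangle[OF core_fiberD(1)[OF yY a(1)] n(2) pX] n(3) N a(2) commute[of p "s n"] by linarith
    then show ?thesis
      using a(1) by blast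
  qed
  then have "f p = y"
    by (rule core_fiber_limit[OF yY pX])
  then obtain n where "f (s n) \<in> V"
    using seq_cluster_point_preimage[OF p V] y by blast
  then show False
    using s(1)[of n] by (simp add: P_def)
qed

text \<open>A point of \<open>core_fiber z\<close> close to \<open>core_fiber y\<close> could be
  moved slightly to have its image in \<open>V'\<close> and off \<open>E\<close>. Near
  \<open>core_fiber y\<close> only images in \<open>V\<close> or \<open>E\<close> occur.\<close>

lemma core_boundary_fibers_apart:
  assumes y: "y \<in> topspace Y" and z: "z \<in> topspace Y" and "y \<noteq> z"
    and bd: "core_fiber z = boundary_fiber z"
  shows "\<exists>r>0. \<forall>a\<in>core_fiber y. \<forall>b\<in>core_fiber z. r \<le> d a b"
proof -
  obtain V V' where V: "openin Y V" "y \<in> V" "openin Y V'" "z \<in> V'" "disjnt V V'"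
    using Hausdorff y z \<open>y \<noteq> z\<close> unfolding Hausdorff_space_def by metis
  obtain r E where r: "0 < r" "finite E"
      "\<And>a x. \<lbrakk>a \<in> core_fiber y; x \<in> topspace X; d a x < r\<rbrakk> \<Longrightarrow> f x \<in> V \<union> E"
    using near_core_fiber_finite_exceptions[OF V(2,1)] by blast
  have "r/2 \<le> d a b" if a: "a \<in> core_fiber y" and b: "b \<in> core_fiber z" for a b
  proof (rule ccontr)
    assume "\<not> r/2 \<le> d a b"
    obtain x where x: "x \<in> topspace X" "d b x < r/2" "f x \<in> V'" "f x \<notin> E"
      using boundary_fiber_perturb[of b z V' "r/2" E] b bd V r by auto
    have "d a x < r"
      using triangle[OF core_fiberD(1)[OF y a] core_fiberD(1)[OF z b] x(1)] x(2)
        \<open>\<not> r/2 \<le> d a b\<close> by simp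
    then show False
      using r(3)[OF a x(1)] x V(5) by (auto simp: disjnt_iff)
  qed
  then show ?thesis
    using r(1) by (intro exI[of _ "r/2"]) auto
qed

text \<open>By symmetry one boundary fiber is enough; otherwise both sets are single points,
  distinct because their images are.\<close>

lemma core_fibers_apart:
  assumes y: "y \<in> topspace Y" and z: "z \<in> topspace Y" and "y \<noteq> z"
  shows "\<exists>r>0. \<forall>a\<in>core_fiber y. \<forall>b\<in>core_fiber z. r \<le> d a b"
proof -
  consider "core_fiber z = boundary_fiber z" | "core_fiber y = boundary_fiber y"
    | a b where "core_fiber y = {a}" "core_fiber z = {b}"
    using core_fiber_singleton_or_boundary by metis
  then show ?thesis
  proof cases
    case 1
    then show ?thesis
      using core_boundary_fibers_apart assms by blast
  next
    case 2
    then show ?thesis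
      using core_boundary_fibers_apart[of z y] assms commute by metis
  next
    case 3
    then have "a \<in> topspace X" "b \<in> topspace X" "a \<noteq> b"
      using core_fiberD[OF y, of a] core_fiberD[OF z, of b] \<open>y \<noteq> z\<close> by auto
    then show ?thesis
      using 3 mdist_pos_less by (intro exI[of _ "d a b"]) auto
  qed
qed

text \<open>The restriction of \<open>f\<close> to the union of the core fibers is continuous for the metric
  topology, uniformly along each fiber.\<close>

lemma near_core_fiber:
  assumes y: "y \<in> V" and V: "openin Y V"
  shows "\<exists>r>0. \<forall>z\<in>topspace Y. \<forall>a\<in>core_fiber y. \<forall>x\<in>core_fiber z. d a x < r \<longrightarrow> z \<in> V"
proof -
  have yY: "y \<in> topspace Y"
    using y V openin_subset by blast
  obtain r E where r: "0 < r" "finite E"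
      "\<And>a x. \<lbrakk>a \<in> core_fiber y; x \<in> topspace X; d a x < r\<rbrakk> \<Longrightarrow> f x \<in> V \<union> E"
    using near_core_fiber_finite_exceptions[OF y V] by blast
  have "\<forall>z\<in>topspace Y - {y}. \<exists>r>0. \<forall>a\<in>core_fiber y. \<forall>b\<in>core_fiber z. r \<le> d a b"
    using core_fibers_apart yY by blast
  then obtain q where q: "\<And>z. z \<in> topspace Y - {y} \<Longrightarrow> 0 < q z"
      "\<And>z a b. \<lbrakk>z \<in> topspace Y - {y}; a \<in> core_fiber y; b \<in> core_fiber z\<rbrakk> \<Longrightarrow> q z \<le> d a b"
    by metis
  \<comment> \<open>Within radius \<open>r\<close> only core fibers over \<open>E\<close> can
    violate the claim. They are finitely many, so the least of their bounds \<open>q z\<close>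
    excludes them.\<close>
  define t where "t = Min (insert r (q ` (E \<inter> topspace Y - {y})))"
  have fin: "finite (insert r (q ` (E \<inter> topspace Y - {y})))"
    using r(2) by simp
  have t_le: "t \<le> r" "\<And>z. z \<in> E \<inter> topspace Y - {y} \<Longrightarrow> t \<le> q z"
    unfolding t_def using fin by (auto intro!: Min_le)
  have "0 < t"
    unfolding t_def using fin r(1) q(1) by (subst Min_gr_iff) auto
  moreover have "z \<in> V" if z: "z \<in> topspace Y" and a: "a \<in> core_fiber y" and x: "x \<in> core_fiber z"
    and "d a x < t" for z a x
  proof (rule ccontr)
    assume "z \<notin> V"
    have "z \<in> V \<union> E"
      using r(3)[OF a core_fiberD(1)[OF z x]] core_fiberD(2)[OF z x] \<open>d a x < t\<close> t_le(1) by auto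
    then have "z \<in> E \<inter> topspace Y - {y}"
      using \<open>z \<notin> V\<close> y z by auto
    then show False
      using t_le(2) q(2)[OF _ a x] \<open>d a x < t\<close> by fastforce
  qed
  ultimately show ?thesis by blast
qed

section \<open>Upper semicontinuity of the core fibers\<close>

text \<open>A point outside is interior to its fiber, so it has a neighbourhood meeting the union
  only in one core fiber. If that is a boundary, the neighbourhood misses it; if it is a single
  point, this point can be removed.\<close>

lemma closedin_core: "closedin X (\<Union>y\<in>topspace Y. core_fiber y)" (is "closedin X ?C")
  unfolding closedin_def
proof
  show "?C \<subseteq> topspace X"
    using core_fiberD(1) by blast
  show "openin X (topspace X - ?C)"
  proof (subst openin_subopen, intro ballI)
    fix x assume x: "x \<in> topspace X - ?C"
    define y where "y = f x"
    have y: "y \<in> topspace Y"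
      using x surj by (auto simp: y_def)
    then have xK: "x \<notin> core_fiber y"
      using x by blast
    then have "x \<notin> boundary_fiber y"
      by (auto simp: core_fiber_def split: if_splits)
    then obtain W where W: "openin X W" "x \<in> W" "\<And>x'. x' \<in> W \<Longrightarrow> f x' = y"
      using x unfolding boundary_fiber_def y_def by blast
    have WX: "W \<subseteq> topspace X"
      using W(1) openin_subset by blast
    have CK: "x' \<in> core_fiber y" if "x' \<in> W" "x' \<in> ?C" for x'
      using that W(3) core_fiberD(2) by fastforce
    show "\<exists>T. openin X T \<and> x \<in> T \<and> T \<subseteq> topspace X - ?C"
    proof (cases "core_fiber y = boundary_fiber y")
      case True
      then have "x' \<notin> core_fiber y" if "x' \<in> W" for x'
        using W that unfolding boundary_fiber_def by blast
      then have "W \<subseteq> topspace X - ?C"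
        using WX CK by blast
      then show ?thesis
        using W by blast
    next
      case False
      then obtain a where a: "core_fiber y = {a}"
        using core_fiber_singleton_or_boundary by blast
      have "openin X (W - {a})"
        using W(1) by (simp add: openin_remove_finite)
      moreover have "W - {a} \<subseteq> topspace X - ?C"
        using WX CK a by blast
      ultimately show ?thesis
        using W(2) xK a by blast
    qed
  qed
qed

text \<open>Restricted to the closed set \<open>C\<close>, the map \<open>f\<close> is still closed.
  Removing from \<open>Y\<close> the image of the part of \<open>C\<close> outside the open set
  \<open>B\<close> leaves an open set over which all core fibers lie in \<open>B\<close>.\<close>

lemma core_fiber_nbhd:
  assumes y: "y \<in> topspace Y" and "0 < r"
  shows "\<exists>V. openin Y V \<and> y \<in> V \<and> (\<forall>z\<in>V. \<forall>x\<in>core_fiber z. \<exists>a\<in>core_fiber y. d a x < r)"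
proof -
  define C where "C = (\<Union>y\<in>topspace Y. core_fiber y)"
  define B where "B = (\<Union>a\<in>core_fiber y. {x \<in> topspace X. d a x < r})"
  have "openin X B"
    unfolding B_def using core_fiberD(1)[OF y] ball_open by blast
  then have "closedin X (C - B)"
    using closedin_core by (simp add: C_def closedin_diff)
  then have "closedin Y (f ` (C - B))"
    using closed by (simp add: closed_map_def)
  then have V: "openin Y (topspace Y - f ` (C - B))"
    by blast
  have "y \<notin> f ` (C - B)"
  proof
    assume "y \<in> f ` (C - B)"
    then obtain x z where x: "f x = y" "x \<notin> B" "z \<in> topspace Y" "x \<in> core_fiber z"
      by (auto simp: C_def)
    then have "x \<in> core_fiber y" "x \<in> topspace X"
      using core_fiberD by auto
    then show False
      using x(2) \<open>0 < r\<close> by (auto simp: B_def)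
  qed
  then have yV: "y \<in> topspace Y - f ` (C - B)"
    using y by blast
  have near: "\<exists>a\<in>core_fiber y. d a x < r"
    if z: "z \<in> topspace Y - f ` (C - B)" and x: "x \<in> core_fiber z" for z x
  proof -
    have "x \<in> C" "f x = z"
      using z x core_fiberD(2) by (auto simp: C_def)
    then show ?thesis
      using z by (auto simp: B_def)
  qed
  show ?thesis
    by (intro exI[of _ "topspace Y - f ` (C - B)"] conjI ballI V yV near)
qed

section \<open>Verification of Frink's conditions\<close>

lemma metrizable_image: "metrizable_space Y"
proof -
  \<comment> \<open>The condition is one-sided: the core fiber over \<open>z\<close> stays near that
    over \<open>y\<close>, but need not come near all of it.\<close>
  define W where "W n y = {z \<in> topspace Y. \<forall>x\<in>core_fiber z. \<exists>a\<in>core_fiber y. d a x < (1/2)^n}"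
    for n y
  show ?thesis
  proof (rule frink_metrization[of Y W])
    show "t1_space Y"
      using Hausdorff by (rule Hausdorff_imp_t1_space)
    show "W n y \<subseteq> topspace Y" for n y
      by (auto simp: W_def)
    show "W (Suc n) y \<subseteq> W n y" for n y
    proof -
      have "d a x < (1/2)^n" if "d a x < (1/2)^Suc n" for a x
        by (rule less_le_trans[OF that]) simp
      then show ?thesis
        unfolding W_def by blast
    qed
    show "\<exists>V. openin Y V \<and> y \<in> V \<and> V \<subseteq> W n y" if y: "y \<in> topspace Y" for n y
    proof -
      obtain V where V: "openin Y V" "y \<in> V"
          "\<forall>z\<in>V. \<forall>x\<in>core_fiber z. \<exists>a\<in>core_fiber y. d a x < (1/2)^n"
        using core_fiber_nbhd[OF y, of "(1/2)^n"] by auto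
      then have "V \<subseteq> W n y"
        using openin_subset[OF V(1)] by (auto simp: W_def)
      then show ?thesis
        using V by blast
    qed
    show "\<exists>n. W n y \<subseteq> V" if V: "openin Y V" "y \<in> V" for V y
    proof -
      obtain r where r: "0 < r" "\<And>z a x. \<lbrakk>z \<in> topspace Y; a \<in> core_fiber y; x \<in> core_fiber z;
          d a x < r\<rbrakk> \<Longrightarrow> z \<in> V"
        using near_core_fiber[OF V(2,1)] by blast
      obtain n where n: "(1/2::real)^n < r"
        using real_arch_pow_inv[OF r(1), of "1/2"] by auto
      have "z \<in> V" if z: "z \<in> W n y" for z
      proof -
        obtain x where x: "x \<in> core_fiber z"
          using core_fiber_nonempty by blast
        then obtain a where "a \<in> core_fiber y" "d a x < (1/2)^n"
          using z by (auto simp: W_def)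
        then show ?thesis
          using r(2) x z n by (force simp: W_def)
      qed
      then show ?thesis by blast
    qed
    show "\<exists>m. \<forall>z\<in>topspace Y. W m y \<inter> W m z \<noteq> {} \<longrightarrow> W m z \<subseteq> W n y"
      if y: "y \<in> topspace Y" for n y
    proof -
      \<comment> \<open>Core fibers over \<open>V\<close> are within \<open>(1/2)^Suc n\<close> of
        that over \<open>y\<close>, and any core fiber coming within \<open>r\<close> of it lies
        over \<open>V\<close>. Then \<open>m\<close> is chosen so that two steps stay below
        \<open>r\<close> and one below \<open>(1/2)^Suc n\<close>.\<close>
      obtain V where V: "openin Y V" "y \<in> V"
          "\<And>z x. z \<in> V \<Longrightarrow> x \<in> core_fiber z \<Longrightarrow> \<exists>a\<in>core_fiber y. d a x < (1/2)^Suc n"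
        using core_fiber_nbhd[OF y, of "(1/2)^Suc n"] by auto
      obtain r where r: "0 < r" "\<And>z a x. \<lbrakk>z \<in> topspace Y; a \<in> core_fiber y; x \<in> core_fiber z;
          d a x < r\<rbrakk> \<Longrightarrow> z \<in> V"
        using near_core_fiber[OF V(2,1)] by blast
      have pos: "0 < min (r/2) ((1/2)^Suc n)"
        using r(1) by simp
      obtain m where "(1/2::real)^m < min (r/2) ((1/2)^Suc n)"
        using real_arch_pow_inv[OF pos, of "1/2"] by auto
      then have m: "(1/2::real)^m < r/2" "(1/2::real)^m < (1/2)^Suc n"
        by auto
      have "u \<in> W n y" if z: "z \<in> topspace Y" and w: "w \<in> W m y" "w \<in> W m z" and u: "u \<in> W m z"
        for z w u
      proof -
        have wY: "w \<in> topspace Y" and uY: "u \<in> topspace Y"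
          using w u by (auto simp: W_def)
        obtain x where x: "x \<in> core_fiber w"
          using core_fiber_nonempty by blast
        then obtain a b where ab: "a \<in> core_fiber y" "d a x < (1/2)^m"
            "b \<in> core_fiber z" "d b x < (1/2)^m"
          using w unfolding W_def by blast
        note inX = core_fiberD(1)[OF y] core_fiberD(1)[OF z] core_fiberD(1)[OF wY]
          core_fiberD(1)[OF uY]
        \<comment> \<open>One close pair is enough to place \<open>z\<close> in \<open>V\<close>; it
          is found through a core point over the common element \<open>w\<close>.\<close>
        have "d a b < r"
          using triangle[of a x b] commute[of x b] ab m(1) inX x by force
        then have "z \<in> V"
          using r(2) z ab by blast
        have "\<exists>a\<in>core_fiber y. d a x' < (1/2)^n" if x': "x' \<in> core_fiber u" for x'
        proof -
          obtain b' where b': "b' \<in> core_fiber z" "d b' x' < (1/2)^m"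
            using u x' by (auto simp: W_def)
          obtain a' where a': "a' \<in> core_fiber y" "d a' b' < (1/2)^Suc n"
            using V(3)[OF \<open>z \<in> V\<close> b'(1)] by blast
          have "d a' x' < (1/2)^n"
            using triangle[of a' b' x'] a' b' m(2) inX x' by force
          then show ?thesis
            using a'(1) by blast
        qed
        then show ?thesis
          using uY by (auto simp: W_def)
      qed
      then show ?thesis by blast
    qed
  qed
qed

end

section \<open>The metric on the domain and the conclusion\<close>

theorem theorem24:
  fixes X :: "'a topology" and Y :: "'b topology" and f :: "'a \<Rightarrow> 'b"
  assumes "submetrizable_space X"
    and "Hausdorff_space Y"
    and "M_space Y"
    and "continuous_map X Y f"
    and "f ` topspace X = topspace Y"
    and "closed_map X Y f"
  shows "metrizable_space Y"
proof -
  obtain \<U> :: "nat \<Rightarrow> 'b set set" where \<U>: "\<forall>n. open_cover_of Y (\<U> n)"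
      "\<forall>n. star_refines (\<U> (Suc n)) (\<U> n)"
      "\<forall>y\<in>topspace Y. \<forall>s. (\<forall>n. s n \<in> point_star y (\<U> n)) \<longrightarrow> (\<exists>z. seq_cluster_point Y s z)"
    using assms(3) unfolding M_space_def by (elim exE conjE) (rule that)
  have cover: "\<Union>(\<U> n) = topspace Y" for n
    using \<U>(1) by (simp add: open_cover_of_def)
  \<comment> \<open>Since \<open>A\<close> meets \<open>B\<close>, it is nonempty and meets itself,
    so both sets belong to the star of \<open>A\<close>.\<close>
  have pairs: "\<exists>C\<in>\<U> n. A \<union> B \<subseteq> C" if AB: "A \<in> \<U> (Suc n)" "B \<in> \<U> (Suc n)" "A \<inter> B \<noteq> {}" for n A B
  proof -
    obtain C where "C \<in> \<U> n" "\<Union>{W \<in> \<U> (Suc n). W \<inter> A \<noteq> {}} \<subseteq> C"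
      using \<U>(2) AB(1) unfolding star_refines_def by blast
    then show ?thesis
      using AB by blast
  qed
  obtain \<rho> :: "'b \<Rightarrow> 'b \<Rightarrow> real" where \<rho>:
    "\<And>x y. 0 \<le> \<rho> x y" "\<And>x. \<rho> x x = 0" "\<And>x y. \<rho> x y = \<rho> y x"
    "\<And>x y z. \<rho> x z \<le> \<rho> x y + \<rho> y z"
    "\<And>n x y. y \<in> point_star x (\<U> (2*n)) \<Longrightarrow> \<rho> x y \<le> (1/2)^n"
    "\<And>n x y. x \<in> topspace Y \<Longrightarrow> \<rho> x y < (1/2)^n \<Longrightarrow> y \<in> point_star x (\<U> n)"
  proof (rule pseudometric_from_covers)
    show "\<Union>(\<U> n) = topspace Y" for n
      by (rule cover)
    show "\<exists>C\<in>\<U> n. A \<union> B \<subseteq> C" if "A \<in> \<U> (Suc n)" "B \<in> \<U> (Suc n)" "A \<inter> B \<noteq> {}" for n A B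
      using that by (rule pairs)
  qed (rule that)
  obtain T where T: "topspace T = topspace X" "\<And>U. openin T U \<Longrightarrow> openin X U" "metrizable_space T"
    using assms(1) unfolding submetrizable_space_def by blast
  then obtain M e where Me: "Metric_space M e" "T = Metric_space.mtopology M e"
    unfolding metrizable_space_def by blast
  interpret e: Metric_space M e
    by (rule Me)
  have M: "M = topspace X"
    using T(1) Me(2) by simp
  \<comment> \<open>The metric \<open>e\<close> separates points; the pseudometric summand forces
    images of close points into a common member of a cover.\<close>
  define d where "d x y = e x y + \<rho> (f x) (f y)" for x y
  have metric: "Metric_space (topspace X) d"
  proof
    show "0 \<le> d x y" for x y
      using \<rho>(1) by (simp add: d_def)
    show "d x y = d y x" for x y
      using \<rho>(3) e.commute by (simp add: d_def)
    show "d x y = 0 \<longleftrightarrow> x = y" if "x \<in> topspace X" "y \<in> topspace X" for x y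
      using that M \<rho>(1)[of "f x" "f y"] \<rho>(2) e.nonneg[of x y] by (auto simp: d_def add_nonneg_eq_0_iff)
    show "d x z \<le> d x y + d y z" if "x \<in> topspace X" "y \<in> topspace X" "z \<in> topspace X" for x y z
      using that M e.triangle[of x y z] \<rho>(4)[of "f x" "f z" "f y"] by (simp add: d_def)
  qed
  interpret d: Metric_space "topspace X" d
    by (rule metric)
  have ball: "openin X {x' \<in> topspace X. d x x' < r}" if x: "x \<in> topspace X" for x r
  proof (subst openin_subopen, intro ballI)
    fix y assume "y \<in> {x' \<in> topspace X. d x x' < r}"
    then have y: "y \<in> topspace X" and pos: "0 < (r - d x y) / 2"
      by auto
    obtain n where n: "(1/2::real)^n < (r - d x y) / 2"
      using real_arch_pow_inv[OF pos, of "1/2"] by auto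
    \<comment> \<open>The star at level \<open>2*n\<close> is an open set whose points are within
      \<open>(1/2)^n\<close> of \<open>f y\<close> for \<open>\<rho>\<close>, less than half of the
      distance left.\<close>
    define V where "V = point_star (f y) (\<U> (2*n))"
    have fy: "f y \<in> topspace Y"
      using y assms(5) by blast
    have "openin Y U" if "U \<in> \<U> n" for U n
      using \<U>(1) that by (simp add: open_cover_of_def)
    then have V: "openin Y V" "f y \<in> V"
      using fy cover[of "2*n"] by (auto simp: V_def point_star_def)
    let ?W = "e.mball y ((r - d x y) / 2) \<inter> {z \<in> topspace X. f z \<in> V}"
    have "openin X ?W"
      using T(2) Me(2) V(1) by (intro openin_Int openin_continuous_map_preimage[OF assms(4)]) auto
    moreover have "y \<in> ?W"
    proof -
      have "y \<in> M"
        using y M by simp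
      then show ?thesis
        using y pos V(2) by simp
    qed
    moreover have "d x z < r" if z: "z \<in> ?W" for z
    proof -
      have zX: "z \<in> topspace X"
        using z by auto
      have "\<rho> (f y) (f z) \<le> (1/2)^n"
        using z \<rho>(5) by (simp add: V_def)
      moreover have "e y z < (r - d x y) / 2"
        using z by simp
      ultimately have "d y z < r - d x y"
        using n unfolding d_def[of y z] by argo
      then show ?thesis
        using d.triangle[OF x y zX] by simp
    qed
    ultimately show "\<exists>T. openin X T \<and> y \<in> T \<and> T \<subseteq> {x' \<in> topspace X. d x x' < r}"
      by (intro exI[of _ ?W]) auto
  qed
  interpret closed_map_onto_M_space X Y f d \<U>
  proof (intro closed_map_onto_M_space.intro)
    show "f x' \<in> point_star (f x) (\<U> n)"
      if "x \<in> topspace X" "x' \<in> topspace X" "d x x' < (1/2)^n" for x x' n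
    proof -
      have "\<rho> (f x) (f x') < (1/2)^n"
        using that(3) e.nonneg[of x x'] unfolding d_def by argo
      then show ?thesis
        using \<rho>(6) that(1) assms(5) by blast
    qed
  qed (use assms metric ball \<U>(3) in blast)+
  show ?thesis
    by (rule metrizable_image)
qed

end
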